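(* Let $n\ge 1$, let $\alpha\in(0,1)$ and $\delta>0$, put $$\sigma=\sqrt{2}\,\delta(1+\delta)^2\alpha\sqrt{\frac{1+\alpha}{1-\alpha}}+\frac{(1+\delta)^2\alpha^2}{2(1-\alpha)},$$ and assume that $$\mu=\frac{(1+\delta)^3\alpha}{1-\alpha}\in(0,1),\qquad \beta=\frac{\alpha-\sigma}{1+\frac{\alpha}{\sqrt{2n}}}>0 .$$ (1) Let $\tau>0$, $z\in\mathbb{R}^n$, $x,s,\tilde x,\tilde s\in\mathbb{R}^{2n}$ satisfy $$(x,s)>0,\qquad \xi:=\frac{\|x\odot s-\tau e\|}{\tau}\le\alpha,$$ $$\frac{\tilde x_i}{x_i}\in\Big[\frac{1}{1+\delta},1+\delta\Big],\qquad \frac{\tilde s_i}{s_i}\in\Big[\frac{1}{1+\delta},1+\delta\Big],\qquad i=1,\dots,2n.$$ Let $(\Delta z,\Delta x,\Delta s)$ be the approximated Newton direction at $(z,x,s)$ with approximation $(\tilde x,\tilde s)$ and parameter $\tau$ (defined in the context), and set $$(z^+,x^+,s^+)=(z,x,s)+(\Delta z,\Delta x,\Delta s),\qquad \tau^+=\Big(1-\frac{\beta}{\sqrt{2n}}\Big)\tau .$$ Then $$(x^+,s^+)>0,\qquad \xi^+:=\frac{\|x^+\odot s^+-\tau^+e\|}{\tau^+}\le\alpha .$$ (2) Furthermore, let $0<\epsilon<2n+\alpha\sqrt{2n}$. If the update $(z,x,s,\tau)\mapsto(z^+,x^+,s^+,\tau^+)$ of (1) is iterated starting from the initial point $(z^0,x^0,s^0)$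 described in the context and $\tau^0=1$, using at each iteration some $\tilde x,\tilde s\in\mathbb{R}^{2n}$ that satisfy, with respect to the current $x,s$, the conditions $\frac{\tilde x_i}{x_i}\in\big[\frac{1}{1+\delta},1+\delta\big]$ and $\frac{\tilde s_i}{s_i}\in\big[\frac{1}{1+\delta},1+\delta\big]$ for all $i=1,\dots,2n$, then after exactly $$\mathcal{N}_{\mathrm{iter}}=\left\lceil\frac{\log\left(\frac{2n+\alpha\sqrt{2n}}{\epsilon}\right)}{-\log\left(1-\frac{\beta}{\sqrt{2n}}\right)}\right\rceil$$ iterations the inequality $x^\top s\le\epsilon$ holds.
   Context: Conventions: $\odot$ is the componentwise (Hadamard) product; inequalities between vectors are componentwise; $e$ is the all-ones vector of appropriate dimension; $\|\cdot\|$ is the Euclidean norm; $\mathrm{col}(a,b)=[a^\top,b^\top]^\top$. Setting: $H=H^\top\in\mathbb{R}^{n\times n}$ is positive semidefinite, $h\in\mathbb{R}^n$, $h\neq0$; these are the data of the box-constrained QP $\min_{z\in\mathbb{R}^n}\frac12 z^\top Hz+z^\top h$ s.t. $-e\le z\le e$. Put $\lambda=\frac{\alpha}{\sqrt{2n}}$, $\tilde H=\frac{1}{\|h\|_\infty}H$, $\tilde h=\frac{1}{\|h\|_\infty}h$, and $\Omega=[I,-I]\in\mathbb{R}^{n\times 2n}$. Write $x=\mathrm{col}(\gamma,\theta)$, $s=\mathrm{col}(\phi,\psi)$ with $\gamma,\theta,\phi,\psi\in\mathbb{R}^n$ (multipliers and slacks). Approximated Newton direction: the solution $(\Delta z,\Delta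 x,\Delta s)\in\mathbb{R}^n\times\mathbb{R}^{2n}\times\mathbb{R}^{2n}$ of the linear system $$2\lambda\tilde H\Delta z+\Omega\Delta x=0,\qquad \Omega^\top\Delta z+\Delta s=0,\qquad \tilde s\odot\Delta x+\tilde x\odot\Delta s=\tau e-x\odot s .$$ Initial point: $z^0=0$, $x^0=\mathrm{col}(\gamma^0,\theta^0)$, $s^0=\mathrm{col}(\phi^0,\psi^0)$ with $\gamma^0=e-\lambda\tilde h$, $\theta^0=e+\lambda\tilde h$, $\phi^0=\psi^0=e$. *)

theory Defs
  imports "HOL-Analysis.Analysis"
begin

(* The dimension n is CARD('n), and R^(2n) is real ^ ('n + 'n).  On real ^ 'm the library's
   x * y is the Hadamard product and 1 is the all-ones vector.  The library's x < y is not the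
   componentwise strict order, so strict positivity is spelled out below. *)

definition positive_semidefinite :: "real ^ 'n ^ 'n \<Rightarrow> bool" where
  "positive_semidefinite H \<longleftrightarrow> transpose H = H \<and> (\<forall>v. 0 \<le> v \<bullet> (H *v v))"

definition positive_vec :: "real ^ 'm \<Rightarrow> bool" where
  "positive_vec x \<longleftrightarrow> (\<forall>i. 0 < x $ i)"

definition col :: "'a ^ 'n \<Rightarrow> 'a ^ 'm \<Rightarrow> 'a ^ ('n + 'm)" where
  "col a b = (\<chi> k. case k of Inl i \<Rightarrow> a $ i | Inr j \<Rightarrow> b $ j)"

(* Row i of the block matrix [I, -I]. *)
definition Omega :: "real ^ ('n + 'n) ^ 'n" where
  "Omega = (\<chi> i. col ((mat 1 :: real ^ 'n ^ 'n) $ i) ((- mat 1 :: real ^ 'n ^ 'n) $ i))"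

definition lam :: "real \<Rightarrow> nat \<Rightarrow> real" where
  "lam \<alpha> n = \<alpha> / sqrt (2 * real n)"

(* infnorm is the maximum norm: the supremum of the absolute values of the coordinates. *)
definition H_scaled :: "real ^ 'n ^ 'n \<Rightarrow> real ^ 'n \<Rightarrow> real ^ 'n ^ 'n" where
  "H_scaled H h = (1 / infnorm h) *\<^sub>R H"

definition h_scaled :: "real ^ 'n \<Rightarrow> real ^ 'n" where
  "h_scaled h = (1 / infnorm h) *\<^sub>R h"

definition newton_system ::
  "real ^ 'n ^ 'n \<Rightarrow> real ^ 'n \<Rightarrow> real \<Rightarrow> real ^ ('n + 'n) \<Rightarrow> real ^ ('n + 'n) \<Rightarrow>
   real ^ ('n + 'n) \<Rightarrow> real ^ ('n + 'n) \<Rightarrow> real \<Rightarrow>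
   real ^ 'n \<Rightarrow> real ^ ('n + 'n) \<Rightarrow> real ^ ('n + 'n) \<Rightarrow> bool" where
  "newton_system H h \<alpha> xt st x s \<tau> dz dx ds \<longleftrightarrow>
     (2 * lam \<alpha> CARD('n)) *\<^sub>R (H_scaled H h *v dz) + Omega *v dx = 0 \<and>
     transpose Omega *v dz + ds = 0 \<and>
     st * dx + xt * ds = \<tau> *\<^sub>R 1 - x * s"

(* THE is an unspecified triple unless the system has exactly one solution.
   The system does not involve z. *)
definition newton_direction ::
  "real ^ 'n ^ 'n \<Rightarrow> real ^ 'n \<Rightarrow> real \<Rightarrow> real ^ ('n + 'n) \<Rightarrow> real ^ ('n + 'n) \<Rightarrow>
   real ^ ('n + 'n) \<Rightarrow> real ^ ('n + 'n) \<Rightarrow> real \<Rightarrow>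
   (real ^ 'n) \<times> (real ^ ('n + 'n)) \<times> (real ^ ('n + 'n))" where
  "newton_direction H h \<alpha> xt st x s \<tau> =
     (THE (dz, dx, ds). newton_system H h \<alpha> xt st x s \<tau> dz dx ds)"

type_synonym 'n iterate = "(real ^ 'n) \<times> (real ^ ('n + 'n)) \<times> (real ^ ('n + 'n)) \<times> real"

definition ipm_step ::
  "real ^ 'n ^ 'n \<Rightarrow> real ^ 'n \<Rightarrow> real \<Rightarrow> real \<Rightarrow> real ^ ('n + 'n) \<Rightarrow> real ^ ('n + 'n) \<Rightarrow>
   'n iterate \<Rightarrow> 'n iterate" where
  "ipm_step H h \<alpha> \<beta> xt st = (\<lambda>(z, x, s, \<tau>).
     case newton_direction H h \<alpha> xt st x s \<tau> of (dz, dx, ds) \<Rightarrow>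
       (z + dz, x + dx, s + ds, (1 - \<beta> / sqrt (2 * real CARD('n))) * \<tau>))"

definition initial_iterate :: "real ^ 'n \<Rightarrow> real \<Rightarrow> 'n iterate" where
  "initial_iterate h \<alpha> =
     (0,
      col (1 - lam \<alpha> CARD('n) *\<^sub>R h_scaled h) (1 + lam \<alpha> CARD('n) *\<^sub>R h_scaled h),
      col 1 1,
      1)"

definition proximity :: "real ^ 'm \<Rightarrow> real ^ 'm \<Rightarrow> real \<Rightarrow> real" where
  "proximity x s \<tau> = norm (x * s - \<tau> *\<^sub>R 1) / \<tau>"

definition approximates :: "real \<Rightarrow> real ^ 'm \<Rightarrow> real ^ 'm \<Rightarrow> bool" where
  "approximates \<delta> xt x \<longleftrightarrow> (\<forall>i. xt $ i / x $ i \<in> {1 / (1 + \<delta>) .. 1 + \<delta>})"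

end

theory Submission
  imports Defs
begin

text \<open>
  Two facts drive the method. The first is that the Newton direction satisfies
  \<open>dx \<bullet> ds \<ge> 0\<close>: the first two equations of the system turn this inner product into a nonnegative
  multiple of the quadratic form of \<open>H\<close> at \<open>dz\<close>. The second is that expanding
  \<open>(x + dx) * (s + ds)\<close> and inserting the third equation leaves
  \<open>\<tau> *\<^sub>R 1 + (s - st) * dx + (x - xt) * ds + dx * ds\<close>,
  so that the error consists of two terms caused by the approximation and one quadratic term.

  All three terms become comparable after rescaling to \<open>p = sqrt (st / xt) * dx\<close> and
  \<open>q = sqrt (xt / st) * ds\<close>. This keeps all the products \<open>dx $ i * ds $ i\<close>, hence \<open>p \<bullet> q \<ge> 0\<close>, and
  turns the third equation into \<open>p + q = (\<tau> *\<^sub>R 1 - x * s) / sqrt (xt * st)\<close>. Because the angle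
  is not obtuse, the squared norms of \<open>p\<close> and \<open>q\<close> add up to at most that of \<open>p + q\<close>, and proximity
  at most \<open>\<alpha>\<close> makes this at most
  \<open>R\<^sup>2 = (1 + \<delta>)\<^sup>2 * \<alpha>\<^sup>2 * \<tau> / (1 - \<alpha>)\<close> (\<open>newton_energy_le\<close>). Everything else is read off from \<open>R\<close>:
  the quadratic term has norm at most \<open>R\<^sup>2 / 2\<close>, the approximation terms together at most
  \<open>sqrt 2 * \<delta> * sqrt ((1 + \<alpha>) * \<tau>) * R\<close>, which gives the bound \<open>\<sigma> * \<tau>\<close> on the error
  (\<open>newton_complementarity_error_le\<close>); and \<open>\<bar>dx $ i\<bar>\<close> is at most \<open>(1 + \<delta>)\<^sup>2 * \<alpha> / (1 - \<alpha>)\<close> times \<open>x $ i\<close>,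
  a factor below \<open>\<mu> < 1\<close>, so positivity survives (\<open>direction_entry_less\<close>).

  The number \<open>\<beta>\<close> is the largest reduction of \<open>\<tau>\<close> that this error bound permits:
  moving the target from \<open>\<tau>\<close> to \<open>(1 - \<beta> / sqrt (2 * n)) * \<tau>\<close> adds \<open>\<beta> * \<tau>\<close> to the error, and
  \<open>\<sigma> + \<beta> = \<alpha> * (1 - \<beta> / sqrt (2 * n))\<close> says that proximity \<open>\<alpha>\<close> is then just restored
  (\<open>proximity_reduced_parameter_le\<close>).

  The sign of \<open>dx \<bullet> ds\<close> also makes the direction well defined: for zero right-hand side the third
  equation forces \<open>dx \<bullet> ds \<le> 0\<close> with equality only for \<open>dx = 0\<close>, so the square linear system is
  injective (\<open>newton_system_unique_solution\<close>).
  The iteration bound follows since the initial point has proximity at most \<open>\<alpha>\<close>, \<open>\<tau>\<close> decreases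
  geometrically, and inside the neighbourhood \<open>x \<bullet> s \<le> \<tau> * (2 * n + \<alpha> * sqrt (2 * n))\<close> by
  Cauchy-Schwarz.
\<close>

section \<open>Entrywise approximations\<close>

lemma approximates_bounds:
  assumes "approximates \<delta> xt x" "positive_vec x" "0 < \<delta>"
  shows "0 < xt $ i" "x $ i \<le> (1 + \<delta>) * xt $ i" "xt $ i \<le> (1 + \<delta>) * x $ i"
proof -
  have x: "0 < x $ i" and t: "1 / (1 + \<delta>) \<le> xt $ i / x $ i" "xt $ i / x $ i \<le> 1 + \<delta>"
    using assms by (auto simp: approximates_def positive_vec_def)
  show "x $ i \<le> (1 + \<delta>) * xt $ i" "xt $ i \<le> (1 + \<delta>) * x $ i"
    using t x \<open>0 < \<delta>\<close> by (simp_all add: field_simps)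
  have "0 < xt $ i / x $ i"
    using t(1) \<open>0 < \<delta>\<close> by (smt (verit) divide_pos_pos)
  with x show "0 < xt $ i" by (simp add: zero_less_divide_iff)
qed

text \<open>
  The error of an approximation, weighted as it occurs after rescaling. The function
  \<open>(1 - t)\<^sup>2 / t\<close> of the ratio \<open>t = a' / a\<close> takes its maximum over \<open>{1 / (1 + \<delta>) .. 1 + \<delta>}\<close>
  at both endpoints, with value \<open>\<delta>\<^sup>2 / (1 + \<delta>)\<close>; the denominator \<open>1 + \<delta>\<close> cancels the loss from
  replacing \<open>b'\<close> by \<open>b\<close>.
\<close>

lemma relative_error_le:
  fixes a b a' b' \<delta> :: real
  assumes pos: "0 < a" "0 < b" "0 < a'" "0 < b'" "0 < \<delta>"
    and a: "a \<le> (1 + \<delta>) * a'" "a' \<le> (1 + \<delta>) * a" and b: "b' \<le> (1 + \<delta>) * b"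
  shows "\<bar>a - a'\<bar> * sqrt (b' / a') \<le> \<delta> * sqrt (a * b)"
proof -
  \<comment> \<open>The two factors vanish at the endpoints of the admissible interval for \<open>a' / a\<close>.\<close>
  have "0 \<le> ((1 + \<delta>) * a - a') * ((1 + \<delta>) * a' - a)"
    using a by (intro mult_nonneg_nonneg) auto
  then have *: "(1 + \<delta>) * (a - a')\<^sup>2 \<le> \<delta>\<^sup>2 * (a * a')"
    by (simp add: algebra_simps power2_eq_square)
  have "(a - a')\<^sup>2 * b' \<le> (a - a')\<^sup>2 * ((1 + \<delta>) * b)"
    using b by (intro mult_left_mono) auto
  also have "\<dots> \<le> \<delta>\<^sup>2 * (a * a') * b"
    using mult_right_mono[OF *, of b] pos by (simp add: mult_ac)
  finally have "(a - a')\<^sup>2 * (b' / a') \<le> \<delta>\<^sup>2 * (a * b)"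
    using pos by (simp add: field_simps)
  then have "sqrt ((a - a')\<^sup>2 * (b' / a')) \<le> sqrt (\<delta>\<^sup>2 * (a * b))"
    by (rule real_sqrt_le_mono)
  then show ?thesis
    using pos(5) by (simp only: real_sqrt_mult real_sqrt_abs abs_of_pos)
qed

section \<open>Scaled directions\<close>

text \<open>
  The rescaling that makes primal and dual directions comparable. Exchanging \<open>a\<close> and \<open>b\<close> inverts the
  weights, so one definition serves both: the multiplier direction \<open>dx\<close> is scaled with
  \<open>a = xt\<close>, \<open>b = st\<close> and the slack direction \<open>ds\<close> with the roles exchanged, and facts about the one
  yield facts about the other by symmetry.
\<close>

definition scaled_direction :: "real ^ 'm \<Rightarrow> real ^ 'm \<Rightarrow> real ^ 'm \<Rightarrow> real ^ 'm" where
  "scaled_direction a b d = (\<chi> i. sqrt (b $ i / a $ i) * d $ i)"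

lemma unscale:
  assumes "0 < a $ i" "0 < b $ i"
  shows "d $ i = sqrt (a $ i / b $ i) * scaled_direction a b d $ i"
proof -
  have "sqrt (a $ i / b $ i) * sqrt (b $ i / a $ i) = 1"
    using assms by (simp flip: real_sqrt_mult)
  then show ?thesis
    by (simp add: scaled_direction_def flip: mult.assoc)
qed

lemma scaled_direction_mult:
  assumes "0 < a $ i" "0 < b $ i"
  shows "scaled_direction a b dx $ i * scaled_direction b a ds $ i = dx $ i * ds $ i"
proof -
  have "sqrt (a $ i / b $ i) * sqrt (b $ i / a $ i) = 1"
    using assms by (simp flip: real_sqrt_mult)
  then show ?thesis
    by (simp add: scaled_direction_def algebra_simps flip: mult.assoc)
qed

lemma scaled_direction_add:
  assumes "0 < a $ i" "0 < b $ i"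
  shows "scaled_direction a b dx $ i + scaled_direction b a ds $ i
    = (b * dx + a * ds) $ i / sqrt (a $ i * b $ i)"
proof -
  have 1: "sqrt (b $ i / a $ i) = b $ i / sqrt (a $ i * b $ i)"
    using assms by (simp add: real_sqrt_divide real_sqrt_mult field_simps)
  have 2: "sqrt (a $ i / b $ i) = a $ i / sqrt (a $ i * b $ i)"
    using assms by (simp add: real_sqrt_divide real_sqrt_mult field_simps)
  show ?thesis
    unfolding scaled_direction_def by (simp add: 1 2 add_divide_distrib)
qed

lemma norm_vec_power2: "(norm (x :: real ^ 'm))\<^sup>2 = (\<Sum>i\<in>UNIV. (x $ i)\<^sup>2)"
  by (simp only: power2_norm_eq_inner inner_vec_def) (simp add: power2_eq_square)

text \<open>
  The scaled directions enclose the same inner product as the original ones, so a nonnegative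
  \<open>dx \<bullet> ds\<close> lets the norm of their sum, which the Newton equation prescribes, control both of them.
\<close>

lemma scaled_energy_le:
  fixes dx ds a b :: "real ^ 'm"
  assumes pos: "\<And>i. 0 < a $ i" "\<And>i. 0 < b $ i"
    and angle: "0 \<le> dx \<bullet> ds"
    and c: "0 < c" "\<And>i. c \<le> a $ i * b $ i"
  shows "(norm (scaled_direction a b dx))\<^sup>2 + (norm (scaled_direction b a ds))\<^sup>2
    \<le> (norm (b * dx + a * ds))\<^sup>2 / c"
proof -
  let ?p = "scaled_direction a b dx" and ?q = "scaled_direction b a ds"
  have "?p \<bullet> ?q = dx \<bullet> ds"
    using scaled_direction_mult[OF pos] by (simp add: inner_vec_def)
  then have "(norm ?p)\<^sup>2 + (norm ?q)\<^sup>2 \<le> (norm (?p + ?q))\<^sup>2"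
    using angle by (simp add: power2_norm_eq_inner inner_add inner_commute)
  also have "\<dots> = (\<Sum>i\<in>UNIV. ((b * dx + a * ds) $ i)\<^sup>2 / (a $ i * b $ i))"
  proof -
    have "0 \<le> a $ i * b $ i" for i
      using c less_imp_le order_trans by metis
    then show ?thesis
      using scaled_direction_add[OF pos, where dx = dx and ds = ds]
      by (simp add: norm_vec_power2 power_divide)
  qed
  also have "\<dots> \<le> (\<Sum>i\<in>UNIV. ((b * dx + a * ds) $ i)\<^sup>2 / c)"
    using c pos by (intro sum_mono divide_left_mono) auto
  also have "\<dots> = (norm (b * dx + a * ds))\<^sup>2 / c"
    by (simp add: norm_vec_power2 sum_divide_distrib)
  finally show ?thesis .
qed

text \<open>
  Bounding by the 1-norm and applying \<open>2 * \<bar>p $ i * q $ i\<bar> \<le> (p $ i)\<^sup>2 + (q $ i)\<^sup>2\<close> in each entry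
  gives the constant \<open>1 / 2\<close>.
\<close>

lemma norm_hadamard_le:
  fixes p q :: "real ^ 'm"
  shows "norm (p * q) \<le> ((norm p)\<^sup>2 + (norm q)\<^sup>2) / 2"
proof -
  have "norm (p * q) \<le> (\<Sum>i\<in>UNIV. \<bar>(p * q) $ i\<bar>)"
    by (rule norm_le_l1_cart)
  also have "\<dots> \<le> (\<Sum>i\<in>UNIV. ((p $ i)\<^sup>2 + (q $ i)\<^sup>2) / 2)"
  proof (rule sum_mono)
    fix i
    show "\<bar>(p * q) $ i\<bar> \<le> ((p $ i)\<^sup>2 + (q $ i)\<^sup>2) / 2"
      using sum_squares_bound[of "\<bar>p $ i\<bar>" "\<bar>q $ i\<bar>"] by (simp add: abs_mult)
  qed
  also have "\<dots> = ((norm p)\<^sup>2 + (norm q)\<^sup>2) / 2"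
    by (simp add: norm_vec_power2 sum.distrib flip: sum_divide_distrib)
  finally show ?thesis .
qed

text \<open>
  The factor \<open>sqrt 2\<close> compares \<open>norm p + norm q\<close> with the Euclidean length of the pair of norms.
\<close>

lemma norm_weighted_sum_le:
  fixes u v p q :: "real ^ 'm"
  assumes K: "0 \<le> K" and u: "\<And>i. \<bar>u $ i\<bar> \<le> K * \<bar>p $ i\<bar>" and v: "\<And>i. \<bar>v $ i\<bar> \<le> K * \<bar>q $ i\<bar>"
    and R: "(norm p)\<^sup>2 + (norm q)\<^sup>2 \<le> R\<^sup>2" "0 \<le> R"
  shows "norm (u + v) \<le> sqrt 2 * K * R"
proof -
  have "norm u \<le> norm (K *\<^sub>R p)" "norm v \<le> norm (K *\<^sub>R q)"
    using u v K
    by (auto intro!: norm_le_componentwise_cart simp: abs_mult simp del: norm_scaleR)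
  then have "norm (u + v) \<le> K * (norm p + norm q)"
    using norm_triangle_ineq[of u v] K by (simp add: algebra_simps)
  also have "norm p + norm q \<le> sqrt 2 * R"
  proof (rule power2_le_imp_le)
    show "(norm p + norm q)\<^sup>2 \<le> (sqrt 2 * R)\<^sup>2"
      using R(1) sum_squares_bound[of "norm p" "norm q"]
      by (simp add: power_mult_distrib power2_sum)
  qed (use R(2) in simp)
  finally show ?thesis
    using K by (simp add: mult_left_mono mult.assoc mult.left_commute)
qed

section \<open>The Newton system\<close>

lemma Omega_inner: "dx \<bullet> (transpose Omega *v dz) = (Omega *v dx) \<bullet> dz"
  by (metis dot_lmul_matrix vector_transpose_matrix inner_commute)

text \<open>
  The first half of the transposed constraint matrix is the identity, which makes it injective.
\<close>

lemma transpose_Omega_nth_Inl: "(transpose Omega *v dz) $ Inl i = dz $ i"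
  by (simp add: matrix_vector_mult_def transpose_def Omega_def col_def mat_def
      if_distrib[of "\<lambda>x. x * _"] cong: if_cong)

text \<open>
  Eliminating \<open>ds\<close> and then \<open>Omega *v dx\<close> turns the inner product into a nonnegative multiple of the
  quadratic form of \<open>H\<close> at \<open>dz\<close>.
\<close>

lemma newton_inner_nonneg:
  fixes H :: "real ^ 'n ^ 'n"
  assumes "positive_semidefinite H" "0 \<le> \<alpha>"
    and 1: "(2 * lam \<alpha> CARD('n)) *\<^sub>R (H_scaled H h *v dz) + Omega *v dx = 0"
    and 2: "transpose Omega *v dz + ds = 0"
  shows "0 \<le> dx \<bullet> ds"
proof -
  have "ds = - (transpose Omega *v dz)" "Omega *v dx = - ((2 * lam \<alpha> CARD('n)) *\<^sub>R (H_scaled H h *v dz))"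
    using 1 2 by (simp_all add: eq_neg_iff_add_eq_0 add.commute)
  then have "dx \<bullet> ds = 2 * lam \<alpha> CARD('n) * (dz \<bullet> (H_scaled H h *v dz))"
    by (simp add: Omega_inner inner_commute[of dz] del: transpose_matrix_vector)
  also have "\<dots> = 2 * lam \<alpha> CARD('n) * (1 / infnorm h) * (dz \<bullet> (H *v dz))"
    by (simp add: H_scaled_def flip: scaleR_matrix_vector_assoc)
  also have "\<dots> \<ge> 0"
    using assms(1,2) infnorm_pos_le[of h]
    by (intro mult_nonneg_nonneg) (auto simp: lam_def positive_semidefinite_def)
  finally show ?thesis .
qed

text \<open>
  The third equation makes \<open>ds\<close> a negative multiple of \<open>dx\<close> in each entry, so \<open>dx \<bullet> ds\<close> is minus a
  weighted sum of squares of \<open>dx\<close>; as it is also nonnegative, every square vanishes.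
\<close>

lemma newton_homogeneous_trivial:
  fixes H :: "real ^ 'n ^ 'n" and xt st :: "real ^ ('n + 'n)"
  assumes H: "positive_semidefinite H" "0 \<le> \<alpha>"
    and pos: "positive_vec xt" "positive_vec st"
    and 1: "(2 * lam \<alpha> CARD('n)) *\<^sub>R (H_scaled H h *v dz) + Omega *v dx = 0"
    and 2: "transpose Omega *v dz + ds = 0"
    and 3: "st * dx + xt * ds = 0"
  shows "dz = 0 \<and> dx = 0 \<and> ds = 0"
proof -
  have p: "\<And>i. 0 < xt $ i" "\<And>i. 0 < st $ i"
    using pos by (auto simp: positive_vec_def)
  have *: "dx $ i * ds $ i = - (st $ i / xt $ i) * (dx $ i)\<^sup>2" for i
  proof -
    have "st $ i * dx $ i + xt $ i * ds $ i = 0"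
      using arg_cong[OF 3, of "\<lambda>v. v $ i"] by simp
    then have "ds $ i = - (st $ i / xt $ i) * dx $ i"
      using p(1)[of i] by (simp add: field_simps)
    then show ?thesis by (simp add: power2_eq_square)
  qed
  have "(\<Sum>i\<in>UNIV. st $ i / xt $ i * (dx $ i)\<^sup>2) = - (dx \<bullet> ds)"
    by (simp add: inner_vec_def * sum_negf)
  also have "\<dots> \<le> 0"
    using newton_inner_nonneg[OF H 1 2] by simp
  finally have le: "(\<Sum>i\<in>UNIV. st $ i / xt $ i * (dx $ i)\<^sup>2) \<le> 0" .
  have nn: "0 \<le> st $ i / xt $ i * (dx $ i)\<^sup>2" for i
    using p[of i] by (simp add: less_imp_le)
  have "(\<Sum>i\<in>UNIV. st $ i / xt $ i * (dx $ i)\<^sup>2) = 0"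
    using le nn by (intro antisym sum_nonneg) auto
  then have "st $ i / xt $ i * (dx $ i)\<^sup>2 = 0" for i
    using nn by (subst (asm) sum_nonneg_eq_0_iff) auto
  then have dx: "dx = 0"
    using p by (simp add: vec_eq_iff) (metis less_irrefl)
  have "xt $ i * ds $ i = 0" for i
    using arg_cong[OF 3, of "\<lambda>v. v $ i"] dx by simp
  then have ds: "ds = 0"
    using p(1) by (simp add: vec_eq_iff) (metis less_irrefl)
  have "dz = 0"
    using 2 ds transpose_Omega_nth_Inl[of dz] by (simp add: vec_eq_iff)
  with dx ds show ?thesis by simp
qed

text \<open>
  As many equations as unknowns: an injective linear map from a Euclidean space to itself is surjective.
\<close>

lemma newton_system_unique_solution:
  fixes H :: "real ^ 'n ^ 'n" and xt st :: "real ^ ('n + 'n)"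
  assumes H: "positive_semidefinite H" "0 \<le> \<alpha>"
    and pos: "positive_vec xt" "positive_vec st"
  shows "\<exists>!(dz, dx, ds). newton_system H h \<alpha> xt st x s \<tau> dz dx ds"
proof -
  define F :: "(real ^ 'n) \<times> (real ^ ('n + 'n)) \<times> (real ^ ('n + 'n)) \<Rightarrow> _" where
    "F = (\<lambda>(dz, dx, ds). ((2 * lam \<alpha> CARD('n)) *\<^sub>R (H_scaled H h *v dz) + Omega *v dx,
      transpose Omega *v dz + ds, st * dx + xt * ds))"
  have lin: "linear F"
    by (rule linearI)
      (auto simp: F_def matrix_vector_right_distrib matrix_vector_mult_scaleR algebra_simps
        simp del: transpose_matrix_vector)
  have ker: "d = 0" if "F d = 0" for d
    using that newton_homogeneous_trivial[OF H pos]
    by (cases d) (auto simp: F_def zero_prod_def)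
  have "inj F"
    using ker by (simp add: linear_injective_0[OF lin])
  then have "surj F"
    using lin by (simp add: linear_injective_imp_surjective)
  have F: "newton_system H h \<alpha> xt st x s \<tau> dz dx ds \<longleftrightarrow> F (dz, dx, ds) = (0, 0, \<tau> *\<^sub>R 1 - x * s)"
    for dz dx ds by (simp add: F_def newton_system_def)
  have "\<exists>!d. F d = (0, 0, \<tau> *\<^sub>R 1 - x * s)"
    using \<open>inj F\<close> \<open>surj F\<close> by (metis injD surjD)
  then show ?thesis
    by (simp add: F case_prod_unfold)
qed

lemma newton_direction_solves:
  fixes H :: "real ^ 'n ^ 'n" and xt st :: "real ^ ('n + 'n)"
  assumes "positive_semidefinite H" "0 \<le> \<alpha>" "positive_vec xt" "positive_vec st"
    and "newton_direction H h \<alpha> xt st x s \<tau> = (dz, dx, ds)"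
  shows "newton_system H h \<alpha> xt st x s \<tau> dz dx ds"
  using theI'[OF newton_system_unique_solution[OF assms(1-4), of h x s \<tau>]] assms(5)
  unfolding newton_direction_def by simp

section \<open>One step of the method\<close>

lemma proximity_entry_bounds:
  assumes "0 < \<tau>" "proximity x s \<tau> \<le> \<alpha>"
  shows "(1 - \<alpha>) * \<tau> \<le> x $ i * s $ i" "x $ i * s $ i \<le> (1 + \<alpha>) * \<tau>"
proof -
  have "\<bar>(x * s - \<tau> *\<^sub>R 1) $ i\<bar> \<le> \<alpha> * \<tau>"
    using component_le_norm_cart[of "x * s - \<tau> *\<^sub>R 1" i] assms
    by (simp add: proximity_def field_simps)
  then show "(1 - \<alpha>) * \<tau> \<le> x $ i * s $ i" "x $ i * s $ i \<le> (1 + \<alpha>) * \<tau>"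
    by (simp_all add: abs_le_iff algebra_simps)
qed

text \<open>
  Replacing \<open>xt * st\<close> by \<open>x * s\<close> costs a factor \<open>(1 + \<delta>)\<^sup>2\<close>, and the entries of \<open>x * s\<close> are at least
  \<open>(1 - \<alpha>) * \<tau>\<close>.
\<close>

lemma newton_energy_le:
  fixes x s xt st dx ds :: "real ^ 'm"
  assumes par: "0 < \<alpha>" "\<alpha> < 1" "0 < \<delta>" "0 < \<tau>"
    and pos: "positive_vec x" "positive_vec s" and prox: "proximity x s \<tau> \<le> \<alpha>"
    and appr: "approximates \<delta> xt x" "approximates \<delta> st s"
    and newton: "st * dx + xt * ds = \<tau> *\<^sub>R 1 - x * s" and angle: "0 \<le> dx \<bullet> ds"
  shows "(norm (scaled_direction xt st dx))\<^sup>2 + (norm (scaled_direction st xt ds))\<^sup>2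
    \<le> (1 + \<delta>)\<^sup>2 * \<alpha>\<^sup>2 * \<tau> / (1 - \<alpha>)"
proof -
  note xt = approximates_bounds[OF appr(1) pos(1) par(3)]
  note st = approximates_bounds[OF appr(2) pos(2) par(3)]
  define c where "c = (1 - \<alpha>) * \<tau> / (1 + \<delta>)\<^sup>2"
  have c: "0 < c" using par by (simp add: c_def)
  have "c \<le> xt $ i * st $ i" for i
  proof -
    have "(1 - \<alpha>) * \<tau> \<le> x $ i * s $ i"
      by (rule proximity_entry_bounds[OF par(4) prox])
    also have "\<dots> \<le> ((1 + \<delta>) * xt $ i) * ((1 + \<delta>) * st $ i)"
      using xt st pos par by (intro mult_mono) (auto simp: positive_vec_def less_imp_le)
    finally show ?thesis
      using par by (simp add: c_def divide_le_eq power2_eq_square mult_ac)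
  qed
  then have "(norm (scaled_direction xt st dx))\<^sup>2 + (norm (scaled_direction st xt ds))\<^sup>2
      \<le> (norm (\<tau> *\<^sub>R 1 - x * s))\<^sup>2 / c"
    using scaled_energy_le[of xt st dx ds c] xt(1) st(1) c angle newton by simp
  also have "\<dots> \<le> (\<alpha> * \<tau>)\<^sup>2 / c"
    using prox par c
    by (intro divide_right_mono power_mono)
      (auto simp: proximity_def norm_minus_commute pos_divide_le_eq)
  also have "\<dots> = (1 + \<delta>)\<^sup>2 * \<alpha>\<^sup>2 * \<tau> / (1 - \<alpha>)"
    using par by (simp add: c_def power_mult_distrib power2_eq_square)
  finally show ?thesis .
qed

text \<open>
  Undoing the scaling, \<open>(dx $ i)\<^sup>2\<close> is \<open>xt $ i / st $ i\<close> times the square of a scaled entry. The ratio is at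
  most \<open>(1 + \<delta>)\<^sup>2 * (x $ i)\<^sup>2 / ((1 - \<alpha>) * \<tau>)\<close>, so \<open>\<tau>\<close> cancels against the energy bound and a relative
  change remains that depends on \<open>\<alpha>\<close> and \<open>\<delta>\<close> only. The statement is used for \<open>s\<close> as well, with the
  roles of the two vectors exchanged.
\<close>

lemma direction_entry_less:
  fixes x s xt st dx :: "real ^ 'm"
  assumes par: "0 < \<alpha>" "\<alpha> < 1" "0 < \<delta>" "0 < \<tau>"
    and \<mu>: "(1 + \<delta>) ^ 3 * \<alpha> / (1 - \<alpha>) < 1"
    and pos: "positive_vec x" "positive_vec s" and prox: "proximity x s \<tau> \<le> \<alpha>"
    and appr: "approximates \<delta> xt x" "approximates \<delta> st s"
    and p: "(norm (scaled_direction xt st dx))\<^sup>2 \<le> (1 + \<delta>)\<^sup>2 * \<alpha>\<^sup>2 * \<tau> / (1 - \<alpha>)"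
  shows "\<bar>dx $ i\<bar> < x $ i"
proof -
  let ?p = "scaled_direction xt st dx"
  note xt = approximates_bounds[OF appr(1) pos(1) par(3)]
  note st = approximates_bounds[OF appr(2) pos(2) par(3)]
  have xs: "0 < x $ i" "0 < s $ i" using pos by (auto simp: positive_vec_def)
  define c where "c = (1 - \<alpha>) * \<tau>"
  have c: "0 < c" "c \<le> x $ i * s $ i"
    using par proximity_entry_bounds[OF par(4) prox] by (auto simp: c_def)
  have ratio: "xt $ i / st $ i \<le> (1 + \<delta>)\<^sup>2 * (x $ i)\<^sup>2 / c"
  proof -
    have "c * xt $ i \<le> (x $ i * s $ i) * ((1 + \<delta>) * x $ i)"
      using c xt[of i] xs by (intro mult_mono) auto
    also have "\<dots> \<le> (x $ i * ((1 + \<delta>) * st $ i)) * ((1 + \<delta>) * x $ i)"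
      using xs st[of i] par by (intro mult_right_mono mult_left_mono) auto
    finally show ?thesis
      using c st(1)[of i] by (simp add: field_simps power2_eq_square)
  qed
  have "(dx $ i)\<^sup>2 = xt $ i / st $ i * (?p $ i)\<^sup>2"
    using xt(1)[of i] st(1)[of i]
    by (subst unscale[of xt i st]) (simp_all add: power_mult_distrib less_imp_le)
  also have "\<dots> \<le> (1 + \<delta>)\<^sup>2 * (x $ i)\<^sup>2 / c * ((1 + \<delta>)\<^sup>2 * \<alpha>\<^sup>2 * \<tau> / (1 - \<alpha>))"
  proof (rule mult_mono[OF ratio])
    have "\<bar>?p $ i\<bar>\<^sup>2 \<le> (norm ?p)\<^sup>2"
      by (intro power_mono component_le_norm_cart) simp
    then show "(?p $ i)\<^sup>2 \<le> (1 + \<delta>)\<^sup>2 * \<alpha>\<^sup>2 * \<tau> / (1 - \<alpha>)"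
      using p by simp
  qed (use c in auto)
  also have "\<dots> = ((1 + \<delta>)\<^sup>2 * \<alpha> / (1 - \<alpha>) * x $ i)\<^sup>2"
    using par by (simp add: c_def power2_eq_square)
  finally have "\<bar>dx $ i\<bar> \<le> (1 + \<delta>)\<^sup>2 * \<alpha> / (1 - \<alpha>) * x $ i"
    using xs par by (intro power2_le_imp_le[where x = "\<bar>dx $ i\<bar>"]) (auto simp: less_imp_le)
  also have "\<dots> < 1 * x $ i"
  proof (rule mult_strict_right_mono[OF _ xs(1)])
    have "(1 + \<delta>)\<^sup>2 \<le> (1 + \<delta>) ^ 3"
      using par by (intro power_increasing) auto
    then have "(1 + \<delta>)\<^sup>2 * \<alpha> / (1 - \<alpha>) \<le> (1 + \<delta>) ^ 3 * \<alpha> / (1 - \<alpha>)"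
      using par by (intro divide_right_mono mult_right_mono) auto
    then show "(1 + \<delta>)\<^sup>2 * \<alpha> / (1 - \<alpha>) < 1"
      using \<mu> by linarith
  qed
  finally show ?thesis by simp
qed

text \<open>
  The weight that converts \<open>dx\<close> to its scaled form is exactly the one under which the relative error of
  \<open>st\<close> is bounded by \<open>\<delta>\<close>. With \<open>x\<close> and \<open>s\<close> exchanged this covers the other error term caused by the
  approximation.
\<close>

lemma approximation_error_le:
  fixes x s xt st dx :: "real ^ 'm"
  assumes par: "0 < \<delta>" "0 < \<tau>"
    and pos: "positive_vec x" "positive_vec s" and prox: "proximity x s \<tau> \<le> \<alpha>"
    and appr: "approximates \<delta> xt x" "approximates \<delta> st s"
  shows "\<bar>((s - st) * dx) $ i\<bar> \<le> \<delta> * sqrt ((1 + \<alpha>) * \<tau>) * \<bar>scaled_direction xt st dx $ i\<bar>"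
proof -
  let ?p = "scaled_direction xt st dx"
  note xt = approximates_bounds[OF appr(1) pos(1) par(1), of i]
  note st = approximates_bounds[OF appr(2) pos(2) par(1), of i]
  have xs: "0 < x $ i" "0 < s $ i" using pos by (auto simp: positive_vec_def)
  have "\<bar>s $ i - st $ i\<bar> * sqrt (xt $ i / st $ i) \<le> \<delta> * sqrt (s $ i * x $ i)"
    using xs xt st par by (intro relative_error_le) auto
  also have "\<dots> \<le> \<delta> * sqrt ((1 + \<alpha>) * \<tau>)"
    using proximity_entry_bounds(2)[OF par(2) prox, of i] par
    by (intro mult_left_mono real_sqrt_le_mono) (auto simp: mult.commute)
  finally have "\<bar>s $ i - st $ i\<bar> * sqrt (xt $ i / st $ i) * \<bar>?p $ i\<bar>
      \<le> \<delta> * sqrt ((1 + \<alpha>) * \<tau>) * \<bar>?p $ i\<bar>"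
    by (rule mult_right_mono) simp
  moreover have "\<bar>((s - st) * dx) $ i\<bar> = \<bar>s $ i - st $ i\<bar> * sqrt (xt $ i / st $ i) * \<bar>?p $ i\<bar>"
    using unscale[OF xt(1) st(1), of dx] xt(1) st(1)
    by (simp add: abs_mult mult.assoc)
  ultimately show ?thesis by simp
qed

text \<open>
  The two summands of the constant are the contributions of the approximation and of the
  second-order term of the product.
\<close>

lemma newton_complementarity_error_le:
  fixes x s xt st dx ds :: "real ^ 'm"
  assumes par: "0 < \<alpha>" "\<alpha> < 1" "0 < \<delta>" "0 < \<tau>"
    and pos: "positive_vec x" "positive_vec s" and prox: "proximity x s \<tau> \<le> \<alpha>"
    and appr: "approximates \<delta> xt x" "approximates \<delta> st s"
    and newton: "st * dx + xt * ds = \<tau> *\<^sub>R 1 - x * s" and angle: "0 \<le> dx \<bullet> ds"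
  shows "norm ((x + dx) * (s + ds) - \<tau> *\<^sub>R 1)
    \<le> (sqrt 2 * \<delta> * (1 + \<delta>)\<^sup>2 * \<alpha> * sqrt ((1 + \<alpha>) / (1 - \<alpha>))
       + (1 + \<delta>)\<^sup>2 * \<alpha>\<^sup>2 / (2 * (1 - \<alpha>))) * \<tau>"
proof -
  let ?p = "scaled_direction xt st dx" and ?q = "scaled_direction st xt ds"
  define R where "R = (1 + \<delta>) * \<alpha> * sqrt (\<tau> / (1 - \<alpha>))"
  have R2: "R\<^sup>2 = (1 + \<delta>)\<^sup>2 * \<alpha>\<^sup>2 * \<tau> / (1 - \<alpha>)" and R0: "0 \<le> R"
    using par by (simp_all add: R_def power_mult_distrib)
  have energy: "(norm ?p)\<^sup>2 + (norm ?q)\<^sup>2 \<le> R\<^sup>2"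
    unfolding R2 using newton_energy_le[OF assms] .
  have xt: "\<And>i. 0 < xt $ i" and st: "\<And>i. 0 < st $ i"
    using approximates_bounds(1) appr pos par by blast+
  have "x * s + (st * dx + xt * ds) = \<tau> *\<^sub>R 1"
    using newton by simp
  then have split: "(x + dx) * (s + ds) - \<tau> *\<^sub>R 1 = ((s - st) * dx + (x - xt) * ds) + dx * ds"
    by (simp add: algebra_simps)
  have "norm ((s - st) * dx + (x - xt) * ds) \<le> sqrt 2 * (\<delta> * sqrt ((1 + \<alpha>) * \<tau>)) * R"
  proof (rule norm_weighted_sum_le[OF _ _ _ energy R0])
    show "\<bar>((s - st) * dx) $ i\<bar> \<le> \<delta> * sqrt ((1 + \<alpha>) * \<tau>) * \<bar>?p $ i\<bar>" for i
      using par pos prox appr by (intro approximation_error_le)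
    have "proximity s x \<tau> \<le> \<alpha>"
      using prox by (simp add: proximity_def mult.commute)
    then show "\<bar>((x - xt) * ds) $ i\<bar> \<le> \<delta> * sqrt ((1 + \<alpha>) * \<tau>) * \<bar>?q $ i\<bar>" for i
      using par pos appr by (intro approximation_error_le)
  qed (use par in simp)
  also have "\<dots> = sqrt 2 * \<delta> * (1 + \<delta>) * \<alpha> * sqrt ((1 + \<alpha>) / (1 - \<alpha>)) * \<tau>"
    using par by (simp add: R_def real_sqrt_mult real_sqrt_divide)
  also have "\<dots> \<le> sqrt 2 * \<delta> * (1 + \<delta>)\<^sup>2 * \<alpha> * sqrt ((1 + \<alpha>) / (1 - \<alpha>)) * \<tau>"
    using par self_le_power[of "1 + \<delta>" 2] by (intro mult_right_mono mult_left_mono) auto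
  finally have 1: "norm ((s - st) * dx + (x - xt) * ds) \<le> \<dots>" .
  have "dx * ds = ?p * ?q"
    using scaled_direction_mult[OF xt st] by (simp add: vec_eq_iff)
  then have "norm (dx * ds) \<le> R\<^sup>2 / 2"
    using norm_hadamard_le[of ?p ?q] energy by simp
  also have "\<dots> = (1 + \<delta>)\<^sup>2 * \<alpha>\<^sup>2 / (2 * (1 - \<alpha>)) * \<tau>"
    by (simp add: R2)
  finally show ?thesis
    unfolding split using 1 norm_triangle_ineq[of "(s - st) * dx + (x - xt) * ds" "dx * ds"]
    by (simp only: distrib_right)
qed

lemma norm_one_vec: "norm (1 :: real ^ 'm) = sqrt (real CARD('m))"
  by (simp add: norm_eq_sqrt_inner inner_vec_def)

text \<open>
  The choice of \<open>\<beta>\<close> balances the error \<open>\<sigma>\<close> of the step and the shift \<open>\<beta>\<close> of the target against the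
  smaller radius \<open>\<alpha> * (1 - \<beta> / sqrt m)\<close> of the new neighbourhood, with equality.
\<close>

lemma proximity_reduced_parameter_le:
  fixes x s :: "real ^ 'm" and \<alpha> \<sigma> \<tau> :: real
  defines "\<beta> \<equiv> (\<alpha> - \<sigma>) / (1 + \<alpha> / sqrt (real CARD('m)))"
  assumes err: "norm (x * s - \<tau> *\<^sub>R 1) \<le> \<sigma> * \<tau>"
    and pos: "0 < \<tau>" "0 < \<alpha>" "0 < \<beta>" "\<beta> < sqrt (real CARD('m))"
  shows "proximity x s ((1 - \<beta> / sqrt (real CARD('m))) * \<tau>) \<le> \<alpha>"
proof -
  define m where "m = sqrt (real CARD('m))"
  have m: "0 < m" by (simp add: m_def)
  have bal: "\<sigma> + \<beta> = \<alpha> * (1 - \<beta> / m)"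
  proof -
    have "1 + \<alpha> / m > 0" using pos m by (simp add: add_pos_pos)
    then have "\<beta> * (1 + \<alpha> / m) = \<alpha> - \<sigma>" by (simp add: \<beta>_def m_def)
    then show ?thesis by (simp add: algebra_simps)
  qed
  have t: "0 < (1 - \<beta> / m) * \<tau>"
    using pos m by (simp add: m_def)
  have "x * s - ((1 - \<beta> / m) * \<tau>) *\<^sub>R 1 = (x * s - \<tau> *\<^sub>R 1) + (\<beta> / m * \<tau>) *\<^sub>R 1"
    by (simp add: algebra_simps)
  then have "norm (x * s - ((1 - \<beta> / m) * \<tau>) *\<^sub>R 1)
      \<le> norm (x * s - \<tau> *\<^sub>R 1) + norm ((\<beta> / m * \<tau>) *\<^sub>R (1 :: real ^ 'm))"
    by (metis norm_triangle_ineq)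
  also have "norm ((\<beta> / m * \<tau>) *\<^sub>R (1 :: real ^ 'm)) = \<beta> * \<tau>"
    using pos m by (simp add: norm_one_vec m_def)
  finally have "norm (x * s - ((1 - \<beta> / m) * \<tau>) *\<^sub>R 1) \<le> (\<sigma> + \<beta>) * \<tau>"
    using err by (simp add: algebra_simps)
  then have "norm (x * s - ((1 - \<beta> / m) * \<tau>) *\<^sub>R 1) \<le> \<alpha> * ((1 - \<beta> / m) * \<tau>)"
    unfolding bal by (simp add: mult.assoc)
  then show ?thesis
    using t unfolding proximity_def m_def by (simp add: pos_divide_le_eq)
qed

lemma ipm_step_preserves_neighbourhood:
  fixes H :: "real ^ 'n ^ 'n" and h :: "real ^ 'n" and \<alpha> \<delta> \<sigma> \<beta> :: real
  assumes H: "positive_semidefinite H"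
    and par: "0 < \<alpha>" "\<alpha> < 1" "0 < \<delta>"
    and \<sigma>: "\<sigma> = sqrt 2 * \<delta> * (1 + \<delta>)\<^sup>2 * \<alpha> * sqrt ((1 + \<alpha>) / (1 - \<alpha>))
             + (1 + \<delta>)\<^sup>2 * \<alpha>\<^sup>2 / (2 * (1 - \<alpha>))"
    and \<mu>: "(1 + \<delta>) ^ 3 * \<alpha> / (1 - \<alpha>) < 1"
    and \<beta>: "\<beta> = (\<alpha> - \<sigma>) / (1 + \<alpha> / sqrt (2 * real CARD('n)))" "0 < \<beta>" "\<beta> < sqrt (2 * real CARD('n))"
    and \<tau>: "0 < \<tau>" and pos: "positive_vec x" "positive_vec s" and prox: "proximity x s \<tau> \<le> \<alpha>"
    and appr: "approximates \<delta> xt x" "approximates \<delta> st s"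
    and step: "(zp, xp, sp, \<tau>p) = ipm_step H h \<alpha> \<beta> xt st (z, x, s, \<tau>)"
  shows "positive_vec xp \<and> positive_vec sp \<and> proximity xp sp \<tau>p \<le> \<alpha>"
proof -
  have card: "real CARD('n + 'n) = 2 * real CARD('n)" by simp
  obtain dz dx ds where dir: "newton_direction H h \<alpha> xt st x s \<tau> = (dz, dx, ds)"
    by (cases "newton_direction H h \<alpha> xt st x s \<tau>") auto
  have eqs: "xp = x + dx" "sp = s + ds" "\<tau>p = (1 - \<beta> / sqrt (2 * real CARD('n))) * \<tau>"
    using step by (auto simp: ipm_step_def dir)
  have "positive_vec xt" "positive_vec st"
    using approximates_bounds(1) appr pos par by (auto simp: positive_vec_def)
  then have sys: "newton_system H h \<alpha> xt st x s \<tau> dz dx ds"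
    using newton_direction_solves[OF H _ _ _ dir] par by simp
  then have newton: "st * dx + xt * ds = \<tau> *\<^sub>R 1 - x * s" and angle: "0 \<le> dx \<bullet> ds"
    using newton_inner_nonneg[OF H] par unfolding newton_system_def by (blast intro: less_imp_le)+
  have energy: "(norm (scaled_direction xt st dx))\<^sup>2 + (norm (scaled_direction st xt ds))\<^sup>2
    \<le> (1 + \<delta>)\<^sup>2 * \<alpha>\<^sup>2 * \<tau> / (1 - \<alpha>)"
    by (rule newton_energy_le[OF par \<tau> pos prox appr newton angle])
  have prox': "proximity s x \<tau> \<le> \<alpha>"
    using prox by (simp add: proximity_def mult.commute)
  have "\<bar>dx $ i\<bar> < x $ i" for i
    using energy zero_le_power2[of "norm (scaled_direction st xt ds)"]
    by (intro direction_entry_less[OF par \<tau> \<mu> pos prox appr]) linarith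
  moreover have "\<bar>ds $ i\<bar> < s $ i" for i
    using energy zero_le_power2[of "norm (scaled_direction xt st dx)"]
    by (intro direction_entry_less[OF par \<tau> \<mu> pos(2,1) prox' appr(2,1)]) linarith
  ultimately have "positive_vec xp" "positive_vec sp"
    by (auto simp: positive_vec_def eqs) (smt (verit))+
  moreover have "norm (xp * sp - \<tau> *\<^sub>R 1) \<le> \<sigma> * \<tau>"
    using newton_complementarity_error_le[OF par \<tau> pos prox appr newton angle]
    by (simp add: eqs \<sigma>)
  then have "proximity xp sp \<tau>p \<le> \<alpha>"
    using proximity_reduced_parameter_le[of xp sp \<tau> \<sigma> \<alpha>] \<tau> par \<beta> by (simp only: card eqs(3))
  ultimately show ?thesis by blast
qed

section \<open>The iteration\<close>

text \<open>
  Scaling by the maximum norm puts every entry of \<open>x * s - 1\<close> within \<open>\<alpha> / sqrt (2 * n)\<close> of zero, and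
  there are \<open>2 * n\<close> of them.
\<close>

lemma initial_iterate_centered:
  fixes h :: "real ^ 'n"
  assumes "h \<noteq> 0" "0 < \<alpha>" "\<alpha> < 1" "(z, x, s, \<tau>) = initial_iterate h \<alpha>"
  shows "\<tau> = 1" "positive_vec x" "positive_vec s" "proximity x s 1 \<le> \<alpha>"
proof -
  define l where "l = lam \<alpha> CARD('n)"
  define g where "g = h_scaled h"
  have eqs: "x = col (1 - l *\<^sub>R g) (1 + l *\<^sub>R g)" "s = col 1 1" "\<tau> = 1"
    using assms(4) by (auto simp: initial_iterate_def l_def g_def)
  have m: "1 \<le> sqrt (2 * real CARD('n))"
    using zero_less_card_finite[where 'a='n] by (simp del: zero_less_card_finite)
  have l: "0 < l" "l < 1"
    using assms(2,3) less_le_trans[OF assms(3) m] by (auto simp: l_def lam_def divide_less_eq)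
  have "infnorm h > 0"
    using assms(1) by (simp add: infnorm_pos_lt)
  then have g: "\<bar>g $ i\<bar> \<le> 1" for i
    using component_le_infnorm_cart[of h i] by (simp add: g_def h_scaled_def abs_mult)
  have lg: "\<bar>l * g $ i\<bar> \<le> l" for i
    using mult_left_mono[OF g[of i], of l] l by (simp add: abs_mult)
  show "\<tau> = 1" by (fact eqs)
  show "positive_vec s"
    by (auto simp: eqs positive_vec_def col_def split: sum.split)
  show "positive_vec x"
    using lg l by (auto simp: eqs positive_vec_def col_def split: sum.split) (smt (verit))+
  have "norm (x * s - 1) \<le> norm (l *\<^sub>R (1 :: real ^ ('n + 'n)))"
  proof (rule norm_le_componentwise_cart)
    show "norm ((x * s - 1) $ k) \<le> norm ((l *\<^sub>R (1 :: real ^ ('n + 'n))) $ k)" for k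
      using lg l by (cases k) (auto simp: eqs col_def)
  qed
  also have "\<dots> = \<alpha>"
    using assms(2) m by (simp add: norm_one_vec l_def lam_def)
  finally show "proximity x s 1 \<le> \<alpha>"
    by (simp add: proximity_def)
qed

text \<open>
  The inner product is the sum of the entries of \<open>x * s\<close>; the sum of their deviations from \<open>\<tau>\<close> is
  bounded by Cauchy-Schwarz against the all-ones vector.
\<close>

lemma complementarity_le:
  fixes x s :: "real ^ 'm"
  assumes "0 < \<tau>" "proximity x s \<tau> \<le> \<alpha>"
  shows "x \<bullet> s \<le> \<tau> * (real CARD('m) + \<alpha> * sqrt (real CARD('m)))"
proof -
  have "x \<bullet> s = 1 \<bullet> (x * s - \<tau> *\<^sub>R 1) + \<tau> * real CARD('m)"
    by (simp add: inner_vec_def sum_subtractf)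
  also have "1 \<bullet> (x * s - \<tau> *\<^sub>R 1) \<le> norm (1 :: real ^ 'm) * norm (x * s - \<tau> *\<^sub>R 1)"
    by (rule norm_cauchy_schwarz)
  also have "\<dots> \<le> sqrt (real CARD('m)) * (\<alpha> * \<tau>)"
    using assms by (simp add: norm_one_vec proximity_def pos_divide_le_eq)
  finally show ?thesis
    by (simp add: algebra_simps)
qed

lemma geometric_decrease_le:
  fixes C q \<epsilon> :: real
  assumes "0 < q" "q < 1" "0 < C" "0 < \<epsilon>" "ln (C / \<epsilon>) / (- ln q) \<le> real N"
  shows "q ^ N * C \<le> \<epsilon>"
proof -
  have "ln (C / \<epsilon>) \<le> real N * (- ln q)"
    using assms by (simp add: pos_divide_le_eq del: divide_minus_right)
  moreover have "ln (q ^ N * (C / \<epsilon>)) = real N * ln q + ln (C / \<epsilon>)"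
    using ln_mult_pos[of "q ^ N" "C / \<epsilon>"] assms by (simp add: ln_realpow)
  ultimately have "ln (q ^ N * (C / \<epsilon>)) \<le> ln 1"
    by simp
  then have "q ^ N * (C / \<epsilon>) \<le> 1"
    using assms by (subst (asm) ln_le_cancel_iff) auto
  then show ?thesis
    using assms by (simp add: field_simps)
qed

theorem theorem1:
  fixes H :: "real ^ 'n ^ 'n" and h :: "real ^ 'n" and n :: nat
    and \<alpha> \<delta> \<sigma> \<mu> \<beta> :: real
  assumes "n = CARD('n)"
    and "positive_semidefinite H"
    and "h \<noteq> 0"
    and "0 < \<alpha>" and "\<alpha> < 1"
    and "0 < \<delta>"
    and "\<sigma> = sqrt 2 * \<delta> * (1 + \<delta>)\<^sup>2 * \<alpha> * sqrt ((1 + \<alpha>) / (1 - \<alpha>))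
             + (1 + \<delta>)\<^sup>2 * \<alpha>\<^sup>2 / (2 * (1 - \<alpha>))"
    and "\<mu> = (1 + \<delta>) ^ 3 * \<alpha> / (1 - \<alpha>)" and "0 < \<mu>" and "\<mu> < 1"
    and "\<beta> = (\<alpha> - \<sigma>) / (1 + \<alpha> / sqrt (2 * real n))" and "0 < \<beta>"
  shows
    "(\<forall>\<tau> z x s xt st zp xp sp \<tau>p.
        0 < \<tau> \<longrightarrow> positive_vec x \<longrightarrow> positive_vec s \<longrightarrow>
        proximity x s \<tau> \<le> \<alpha> \<longrightarrow>
        approximates \<delta> xt x \<longrightarrow> approximates \<delta> st s \<longrightarrow>
        (zp, xp, sp, \<tau>p) = ipm_step H h \<alpha> \<beta> xt st (z, x, s, \<tau>) \<longrightarrow>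
        positive_vec xp \<and> positive_vec sp \<and> proximity xp sp \<tau>p \<le> \<alpha>)
     \<and>
     (\<forall>\<epsilon> N Z X S T Xt St.
        0 < \<epsilon> \<longrightarrow> \<epsilon> < 2 * real n + \<alpha> * sqrt (2 * real n) \<longrightarrow>
        N = nat \<lceil>ln ((2 * real n + \<alpha> * sqrt (2 * real n)) / \<epsilon>)
                  / (- ln (1 - \<beta> / sqrt (2 * real n)))\<rceil> \<longrightarrow>
        (Z 0, X 0, S 0, T 0) = initial_iterate h \<alpha> \<longrightarrow>
        (\<forall>k<N. approximates \<delta> (Xt k) (X k) \<and> approximates \<delta> (St k) (S k) \<and>
                (Z (Suc k), X (Suc k), S (Suc k), T (Suc k))
                  = ipm_step H h \<alpha> \<beta> (Xt k) (St k) (Z k, X k, S k, T k)) \<longrightarrow>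
        X N \<bullet> S N \<le> \<epsilon>)"
proof -
  define m where "m = sqrt (2 * real n)"
  have n: "1 \<le> n"
    using assms(1) by (simp add: Suc_leI)
  have m: "1 < m"
    using n by (simp add: m_def)
  \<comment> \<open>Keeps the factor \<open>1 - \<beta> / m\<close> positive, so that \<open>\<tau>\<close> stays positive along the iteration.\<close>
  have \<beta>_less: "\<beta> < m"
  proof -
    have "0 \<le> \<sigma>"
      unfolding assms(7) using assms(4-6) by (intro add_nonneg_nonneg) auto
    moreover have "0 < \<alpha> / m"
      using m assms(4) by simp
    ultimately have "\<alpha> - \<sigma> < (1 + \<alpha> / m)"
      using assms(5) by linarith
    then have "\<beta> < 1"
      unfolding assms(11) m_def[symmetric] using \<open>0 < \<alpha> / m\<close> by (simp add: pos_divide_less_eq)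
    with m show ?thesis by simp
  qed
  define q where "q = 1 - \<beta> / m"
  have q: "0 < q" "q < 1"
    using \<beta>_less m assms(12) by (auto simp: q_def)
  have mu: "(1 + \<delta>) ^ 3 * \<alpha> / (1 - \<alpha>) < 1"
    using assms(8,10) by simp
  note step = ipm_step_preserves_neighbourhood[OF assms(2,4,5,6,7) mu
      assms(11)[unfolded assms(1)] assms(12) \<beta>_less[unfolded m_def assms(1)], where h = h]
  show ?thesis
  proof (intro conjI[rotated])
    show "\<forall>\<epsilon> N Z X S T Xt St.
        0 < \<epsilon> \<longrightarrow> \<epsilon> < 2 * real n + \<alpha> * sqrt (2 * real n) \<longrightarrow>
        N = nat \<lceil>ln ((2 * real n + \<alpha> * sqrt (2 * real n)) / \<epsilon>)
                  / (- ln (1 - \<beta> / sqrt (2 * real n)))\<rceil> \<longrightarrow>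
        (Z 0, X 0, S 0, T 0) = initial_iterate h \<alpha> \<longrightarrow>
        (\<forall>k<N. approximates \<delta> (Xt k) (X k) \<and> approximates \<delta> (St k) (S k) \<and>
                (Z (Suc k), X (Suc k), S (Suc k), T (Suc k))
                  = ipm_step H h \<alpha> \<beta> (Xt k) (St k) (Z k, X k, S k, T k)) \<longrightarrow>
        X N \<bullet> S N \<le> \<epsilon>"
    proof (intro allI impI)
      fix \<epsilon> N Z X S T Xt St
      assume \<epsilon>: "0 < \<epsilon>"
        and N: "N = nat \<lceil>ln ((2 * real n + \<alpha> * sqrt (2 * real n)) / \<epsilon>)
                  / (- ln (1 - \<beta> / sqrt (2 * real n)))\<rceil>"
        and init: "(Z 0, X 0, S 0, T 0) = initial_iterate h \<alpha>"
        and iter: "\<forall>k<N. approximates \<delta> (Xt k) (X k) \<and> approximates \<delta> (St k) (S k) \<and>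
                (Z (Suc k), X (Suc k), S (Suc k), T (Suc k))
                  = ipm_step H h \<alpha> \<beta> (Xt k) (St k) (Z k, X k, S k, T k)"
      have inv: "T k = q ^ k \<and> positive_vec (X k) \<and> positive_vec (S k) \<and>
          proximity (X k) (S k) (T k) \<le> \<alpha>" if "k \<le> N" for k
        using that
      proof (induction k)
        case 0
        then show ?case
          using initial_iterate_centered[OF assms(3,4,5) init] by simp
      next
        case (Suc k)
        then have IH: "T k = q ^ k" "positive_vec (X k)" "positive_vec (S k)"
            "proximity (X k) (S k) (T k) \<le> \<alpha>"
          and it: "approximates \<delta> (Xt k) (X k)" "approximates \<delta> (St k) (S k)"
            "(Z (Suc k), X (Suc k), S (Suc k), T (Suc k))
                  = ipm_step H h \<alpha> \<beta> (Xt k) (St k) (Z k, X k, S k, T k)"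
          using iter by auto
        have "T (Suc k) = q * T k"
          using it(3) by (auto simp: ipm_step_def q_def m_def assms(1) split: prod.splits)
        moreover have "0 < T k" using IH(1) q by simp
        ultimately show ?case
          using step[OF _ IH(2-4) it] IH(1) by simp
      qed
      have T: "T N = q ^ N" and prox: "proximity (X N) (S N) (T N) \<le> \<alpha>"
        using inv[of N] by auto
      have "X N \<bullet> S N \<le> T N * (2 * real n + \<alpha> * sqrt (2 * real n))"
        using complementarity_le[OF _ prox] T q by (simp add: assms(1))
      also have "\<dots> \<le> \<epsilon>"
        unfolding T
      proof (rule geometric_decrease_le[OF q _ \<epsilon>])
        show "0 < 2 * real n + \<alpha> * sqrt (2 * real n)"
          using n assms(4) by (intro add_pos_nonneg) auto
        show "ln ((2 * real n + \<alpha> * sqrt (2 * real n)) / \<epsilon>) / - ln q \<le> real N"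
          unfolding N q_def m_def by (rule real_nat_ceiling_ge)
      qed
      finally show "X N \<bullet> S N \<le> \<epsilon>" .
    qed
  qed (use step in blast)
qed

end
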